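(* Let $\mathbf U\in\mathcal K$ be a cone in a Euclidean space $E$. Let $\mathcal Y$ be a nonempty $\mathcal K$-representable set and $G:\mathcal Y\to E$ a continuous mapping with $G(\mathcal Y)\subset\mathbf U^*$ and with $\mathcal K$-representable $\mathbf U^*$-hypograph $$\{(y,w)\in\mathcal Y\times E: w\leq_{\mathbf U^*}G(y)\}=\{(y,w):\exists u: \underline Ry+\underline Sw+\underline Qu\leq_{\underline{\mathbf K}}\underline s\}\qquad[\underline{\mathbf K}\in\mathcal K],$$ the representation being essentially strictly feasible. Let $\mathcal X$ be a nonempty $\mathcal K$-representable set and $F:\mathcal X\to\mathbf U$ a continuous $\mathbf U$-convex mapping with $\mathcal K$-representable $\mathbf U$-epigraph $$\{(x,z): x\in\mathcal X,\ z\geq_{\mathbf U}F(x)\}=\{(x,z):\exists v:\widehat Rx+\widehat Sz+\widehat Qv\leq_{\widehat{\mathbf K}}\widehat s\}\qquad[\widehat{\mathbf K}\in\mathcal K].$$ Then the function $\psi(x,y)=F(x)^TG(y):\mathcal X\times\mathcal Y\to\mathbb R$ is continuous and convex-concave and admits the $\mathcal K$-representation $$\psi(x,y)=\inf_{f,t,z,v,\lambda}\left\{f^Ty+t:\ \begin{array}{l} f+\underline R^T\lambda=0,\ t=\underline s^T\lambda,\ \underline S^T\lambda=z,\ \underline Q^T\lambda=0,\ \lambda\in\underline{\mathbf K}^*,\\ \widehat Rx+\widehat Sz+\widehat Qv\leq_{\widehat{\mathbf K}}\widehat s\end{array}\right\}\quad\forall x\in\mathcal X,\ y\in\mathcal 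Y.$$
   Context: $\mathcal K$ is a fixed family of regular cones (closed, convex, pointed, with nonempty interior) in Euclidean spaces which contains $\mathbb R_+$, is closed under finite direct products, and is closed under passing from a cone $\mathbf K$ to its dual $\mathbf K^*$. $a\leq_{\mathbf K}b$ means $b-a\in\mathbf K$. $a^Tb$ denotes the inner product. A set $X$ is $\mathcal K$-representable if $X=\{x:\exists u:Ax+Bu\leq_{\mathbf K}c\}$ for some $A,B,c$ and $\mathbf K\in\mathcal K$. Finite systems of $\mathcal K$-conic constraints, linear equalities and nonstrict linear inequalities are again (equivalent to) a single $\mathcal K$-conic constraint. A conic constraint $Ax\leq_{\mathbf K}a$ is essentially strictly feasible if $\mathbf K=\mathbb R^m_+\times\mathbf L$ with regular $\mathbf L$ (either factor may be absent), so that it reads $Px\leq p$, $Qx\leq_{\mathbf L}q$, and there is $\bar x$ with $P\bar x\leq p$ and $q-Q\bar x\in\operatorname{int}\mathbf L$; for a representation of a set this refers to the representing constraint in all its variables. $F$ is $\mathbf U$-convex if $F(\lambda x'+(1-\lambda)x'')\leq_{\mathbf U}\lambda F(x')+(1-\lambda)F(x'')$ for all $x',x''\in\mathcal X$, $\lambda\in[0,1]$. Convex-concave means convex in $x$, concave in $y$. A function $\psi:\mathcal X\times\mathcal Y\to\mathbb R$ admits a $\mathcal K$-representation on $\mathcal X\times\mathcal Y$ if $\psi(x,y)=\inf_{f,t,u}\{f^Ty+t:Pf+tp+Qu+Rx\leq_{\mathbf K}s\}$ for all $x\in\mathcal X,y\in\mathcal Y$, with some $\mathbf K\in\mathcal K$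 (the constraint may be given as an equivalent finite system). *)

theory Defs
  imports "HOL-Analysis.Analysis"
begin

text \<open>
  A family of cones ranges over Euclidean spaces of all dimensions, which no single type of class
  euclidean_space provides. Its members are therefore given in orthonormal coordinates, as sets of
  points of the library's \<open>Euclidean_space n\<close>, the functions \<open>nat \<Rightarrow> real\<close> that vanish from \<open>n\<close> on. A
  cone in a typed Euclidean space belongs to the family if its coordinate image in some
  orthonormal basis does.
\<close>

section \<open>Cones in coordinates\<close>

type_synonym cone_fam = "nat \<Rightarrow> (nat \<Rightarrow> real) set set"

definition vecn :: "nat \<Rightarrow> (nat \<Rightarrow> real) \<Rightarrow> nat \<Rightarrow> real" where
  "vecn n g = (\<lambda>i. if i < n then g i else 0)"

definition regular_cone_coord :: "nat \<Rightarrow> (nat \<Rightarrow> real) set \<Rightarrow> bool" where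
  "regular_cone_coord n C \<longleftrightarrow>
     closedin (Euclidean_space n) C \<and>
     (\<forall>u\<in>C. \<forall>v\<in>C. (\<lambda>i. u i + v i) \<in> C) \<and>
     (\<forall>u\<in>C. \<forall>c\<ge>0. (\<lambda>i. c * u i) \<in> C) \<and>
     (\<forall>u\<in>C. (\<lambda>i. - u i) \<in> C \<longrightarrow> u = (\<lambda>i. 0)) \<and>
     (Euclidean_space n) interior_of C \<noteq> {}"

definition prod_coord :: "nat \<Rightarrow> nat \<Rightarrow> (nat \<Rightarrow> real) set \<Rightarrow> (nat \<Rightarrow> real) set \<Rightarrow> (nat \<Rightarrow> real) set" where
  "prod_coord n m C D =
     {w \<in> topspace (Euclidean_space (n + m)). vecn n w \<in> C \<and> (\<lambda>i. w (n + i)) \<in> D}"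

definition dual_coord :: "nat \<Rightarrow> (nat \<Rightarrow> real) set \<Rightarrow> (nat \<Rightarrow> real) set" where
  "dual_coord n C = {v \<in> topspace (Euclidean_space n). \<forall>u\<in>C. 0 \<le> (\<Sum>i<n. u i * v i)}"

text \<open>\<open>K n\<close> consists of the members of the family that live in dimension \<open>n\<close>.\<close>

definition cone_family :: "cone_fam \<Rightarrow> bool" where
  "cone_family K \<longleftrightarrow>
     (\<forall>n. \<forall>C\<in>K n. regular_cone_coord n C) \<and>
     {x \<in> topspace (Euclidean_space 1). 0 \<le> x 0} \<in> K 1 \<and>
     (\<forall>n m. \<forall>C\<in>K n. \<forall>D\<in>K m. prod_coord n m C D \<in> K (n + m)) \<and>
     (\<forall>n. \<forall>C\<in>K n. dual_coord n C \<in> K n)"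

section \<open>Cones in typed Euclidean spaces\<close>

definition orthonormal_frame :: "(nat \<Rightarrow> 'a::euclidean_space) \<Rightarrow> bool" where
  "orthonormal_frame b \<longleftrightarrow>
     (\<forall>i<DIM('a). \<forall>j<DIM('a). b i \<bullet> b j = (if i = j then 1 else 0))"

definition coords :: "(nat \<Rightarrow> 'a::euclidean_space) \<Rightarrow> 'a \<Rightarrow> nat \<Rightarrow> real" where
  "coords b v = vecn DIM('a) (\<lambda>i. v \<bullet> b i)"

definition in_family :: "'a::euclidean_space set \<Rightarrow> cone_fam \<Rightarrow> bool" where
  "in_family C K \<longleftrightarrow> (\<exists>b. orthonormal_frame b \<and> coords b ` C \<in> K DIM('a))"

definition dual_cone :: "'a::euclidean_space set \<Rightarrow> 'a set" where
  "dual_cone C = {y. \<forall>x\<in>C. 0 \<le> x \<bullet> y}"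

definition cone_le :: "'a::euclidean_space set \<Rightarrow> 'a \<Rightarrow> 'a \<Rightarrow> bool" where
  "cone_le C a b \<longleftrightarrow> b - a \<in> C"

definition U_convex_on ::
    "'e::euclidean_space set \<Rightarrow> 'x::euclidean_space set \<Rightarrow> ('x \<Rightarrow> 'e) \<Rightarrow> bool" where
  "U_convex_on U X F \<longleftrightarrow>
     (\<forall>x'\<in>X. \<forall>x''\<in>X. \<forall>\<mu>\<in>{0..1}.
        cone_le U (F (\<mu> *\<^sub>R x' + (1 - \<mu>) *\<^sub>R x'')) (\<mu> *\<^sub>R F x' + (1 - \<mu>) *\<^sub>R F x''))"

section \<open>Representability\<close>

text \<open>The coefficient matrix of \<open>x\<close> is given by its rows \<open>A i\<close>; the vector \<open>u\<close> has an arbitrary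
  dimension \<open>k\<close>, possibly \<open>0\<close>.\<close>

definition K_representable :: "cone_fam \<Rightarrow> 'a::euclidean_space set \<Rightarrow> bool" where
  "K_representable K X \<longleftrightarrow>
     (\<exists>n k C (A :: nat \<Rightarrow> 'a) (B :: nat \<Rightarrow> nat \<Rightarrow> real) c. C \<in> K n \<and>
        X = {x. \<exists>u. vecn n (\<lambda>i. c i - (A i \<bullet> x + (\<Sum>j<k. B i j * u j))) \<in> C})"

text \<open>Closed convex pointed cones with nonempty interior relative to the subspace \<open>V\<close>.\<close>

definition regular_cone_in :: "'a::euclidean_space set \<Rightarrow> 'a set \<Rightarrow> bool" where
  "regular_cone_in V L \<longleftrightarrow>
     L \<subseteq> V \<and> closed L \<and> convex L \<and> cone L \<and> (\<forall>x\<in>L. - x \<in> L \<longrightarrow> x = 0) \<and>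
     (top_of_set V) interior_of L \<noteq> {}"

text \<open>
  The splitting of the cone into \<open>\<real>\<^sub>+\<^sup>m\<close> times \<open>L\<close> is an orthogonal one: \<open>I\<close> is the orthonormal basis
  of the space of the first factor (absent if \<open>I = {}\<close>), and \<open>L\<close> lives in its orthogonal
  complement (absent if that is \<open>{0}\<close>). For a slack \<open>w = a - A x\<close> the components \<open>w \<bullet> i\<close> are the
  slacks of the linear inequalities, and \<open>orth_proj I w\<close> is the slack of the \<open>L\<close>-constraint.
\<close>

definition orth_proj :: "'a::euclidean_space set \<Rightarrow> 'a \<Rightarrow> 'a" where
  "orth_proj I w = w - (\<Sum>i\<in>I. (w \<bullet> i) *\<^sub>R i)"

definition ess_strictly_feasible ::
    "'k::euclidean_space set \<Rightarrow> ('v \<Rightarrow> 'k) \<Rightarrow> 'k \<Rightarrow> bool" where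
  "ess_strictly_feasible C A a \<longleftrightarrow>
     (\<exists>I L. pairwise orthogonal I \<and> (\<forall>i\<in>I. norm i = 1) \<and>
        regular_cone_in {w. \<forall>i\<in>I. w \<bullet> i = 0} L \<and>
        C = {w. (\<forall>i\<in>I. 0 \<le> w \<bullet> i) \<and> orth_proj I w \<in> L} \<and>
        (\<exists>x. (\<forall>i\<in>I. 0 \<le> (a - A x) \<bullet> i) \<and>
             orth_proj I (a - A x) \<in> (top_of_set {w. \<forall>i\<in>I. w \<bullet> i = 0}) interior_of L))"

text \<open>
  \<open>S\<close> is the solution set, in the variables \<open>(x, f, t, u)\<close>, of the constraints of the representation.
  The first conjunct says that it is the solution set of a single constraint
  \<open>P f + t p + Q u + R x \<le> s\<close> with respect to a cone of the family. The infimum is taken in the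
  extended reals.
\<close>

definition K_representation_on ::
    "cone_fam \<Rightarrow> 'x::euclidean_space set \<Rightarrow> 'y::euclidean_space set \<Rightarrow> ('x \<Rightarrow> 'y \<Rightarrow> real) \<Rightarrow>
     ('x \<times> 'y \<times> real \<times> 'u::euclidean_space) set \<Rightarrow> bool" where
  "K_representation_on K X Y \<psi> S \<longleftrightarrow>
     (\<exists>n C (P :: nat \<Rightarrow> 'y) (p :: nat \<Rightarrow> real) (Q :: nat \<Rightarrow> 'u) (R :: nat \<Rightarrow> 'x) s. C \<in> K n \<and>
        S = {(x, f, t, u).
               vecn n (\<lambda>i. s i - (P i \<bullet> f + t * p i + Q i \<bullet> u + R i \<bullet> x)) \<in> C}) \<and>
     (\<forall>x\<in>X. \<forall>y\<in>Y.
        ereal (\<psi> x y) = (INF (f, t, u) \<in> {(f, t, u). (x, f, t, u) \<in> S}. ereal (f \<bullet> y + t)))"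

end

theory Submission
  imports Defs
begin

text \<open>
  For \<open>z \<in> U\<close> the function \<open>z \<bullet> G\<close> is concave and continuous on \<open>Y\<close>, hence on \<open>Y\<close> it is the
  infimum of its affine majorants \<open>f \<bullet> y + t\<close>. That \<open>f \<bullet> y + t\<close> is a majorant means that
  \<open>z \<bullet> w - f \<bullet> y \<le> t\<close> on the hypograph of \<open>G\<close>, and conic duality for the representation of the
  hypograph turns this into the existence of a multiplier. It remains to minimize over
  \<open>z \<ge> F x\<close>, and the minimum is attained at \<open>z = F x\<close> because \<open>G y\<close> lies in the dual cone.
  Duality is applied in all variables jointly, not for fixed \<open>y\<close>: for fixed \<open>y\<close> the constraint
  need not be essentially strictly feasible.
\<close>

section \<open>Coordinates\<close>

text \<open>Orthonormality makes \<open>b\<close> injective on the index range, so its image has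
  \<open>DIM('a)\<close> independent elements and spans. The residual is orthogonal to this span,
  hence to itself.\<close>

lemma orthonormal_frame_expansion:
  fixes b :: "nat \<Rightarrow> 'a::euclidean_space"
  assumes "orthonormal_frame b"
  shows "(\<Sum>i<DIM('a). (v \<bullet> b i) *\<^sub>R b i) = v"
proof -
  let ?I = "{..<DIM('a)}"
  have inner: "b i \<bullet> b j = (if i = j then 1 else 0)" if "i \<in> ?I" "j \<in> ?I" for i j
    using assms that by (simp add: orthonormal_frame_def)
  have inj: "inj_on b ?I"
    by (rule inj_onI) (metis inner zero_neq_one)
  have "independent (b ` ?I)"
  proof (rule pairwise_orthogonal_independent)
    show "pairwise orthogonal (b ` ?I)"
      by (auto simp: pairwise_def orthogonal_def inner)
    show "0 \<notin> b ` ?I"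
      using inner by (metis imageE inner_zero_left zero_neq_one)
  qed
  then have span: "span (b ` ?I) = UNIV"
    using card_ge_dim_independent[of "b ` ?I" UNIV] by (auto simp: card_image[OF inj])
  define w where "w = v - (\<Sum>i\<in>?I. (v \<bullet> b i) *\<^sub>R b i)"
  have "orthogonal w (b j)" if "j \<in> ?I" for j
  proof -
    have "(\<Sum>i\<in>?I. (v \<bullet> b i) * (b i \<bullet> b j)) = (\<Sum>i\<in>?I. if i = j then v \<bullet> b j else 0)"
      by (rule sum.cong) (use inner that in auto)
    then show ?thesis
      using that by (simp add: w_def orthogonal_def inner_diff_left inner_sum_left)
  qed
  then have "orthogonal w w"
    using orthogonal_to_span[of w "b ` ?I" w] span by blast
  then show ?thesis
    by (simp add: orthogonal_def w_def)
qed

text \<open>Parseval's identity: \<open>coords b\<close> is an isometry, which is what lets dual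
  cones be computed in coordinates.\<close>

lemma inner_coords:
  fixes b :: "nat \<Rightarrow> 'a::euclidean_space"
  assumes "orthonormal_frame b"
  shows "(\<Sum>i<DIM('a). coords b x i * coords b y i) = x \<bullet> y"
proof -
  have "x \<bullet> y = (\<Sum>i<DIM('a). (x \<bullet> b i) *\<^sub>R b i) \<bullet> y"
    by (simp add: orthonormal_frame_expansion[OF assms])
  also have "\<dots> = (\<Sum>i<DIM('a). coords b x i * coords b y i)"
    by (simp add: inner_sum_left coords_def vecn_def inner_commute[of y])
  finally show ?thesis ..
qed

lemma inj_coords:
  fixes b :: "nat \<Rightarrow> 'a::euclidean_space"
  assumes "orthonormal_frame b"
  shows "inj (coords b)"
proof (rule injI)
  fix x y assume eq: "coords b x = coords b y"
  have "z \<bullet> x = z \<bullet> y" for z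
    by (metis eq assms inner_coords)
  then show "x = y"
    by (metis vector_eq_ldot)
qed

lemma coords_add: "coords b (x + y) = (\<lambda>i. coords b x i + coords b y i)"
  by (auto simp: coords_def vecn_def inner_add_left)

lemma coords_scaleR: "coords b (c *\<^sub>R x) = (\<lambda>i. c * coords b x i)"
  by (auto simp: coords_def vecn_def)

text \<open>Closure under sums and nonnegative multiples pulls back along the injective linear map
  \<open>coords b\<close>; nonempty interior rules out the empty set. This gives convexity of the
  solution sets and reflexivity of the cone orders.\<close>

lemma in_family_convex_cone:
  assumes "cone_family K" "in_family C K"
  shows "convex_cone C"
proof -
  obtain b where b: "orthonormal_frame b" and "coords b ` C \<in> K DIM('a)"
    using assms(2) by (auto simp: in_family_def)
  then have reg: "regular_cone_coord DIM('a) (coords b ` C)"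
    using assms(1) by (auto simp: cone_family_def)
  note mem = inj_image_mem_iff[OF inj_coords[OF b]]
  have ne: "C \<noteq> {}"
    using reg interior_of_subset[of "Euclidean_space DIM('a)" "coords b ` C"]
    by (auto simp: regular_cone_coord_def)
  have add: "x + y \<in> C" if "x \<in> C" "y \<in> C" for x y
  proof -
    have "(\<lambda>i. coords b x i + coords b y i) \<in> coords b ` C"
      using reg that unfolding regular_cone_coord_def by blast
    then show ?thesis
      by (simp add: mem flip: coords_add)
  qed
  have scale: "c *\<^sub>R x \<in> C" if "x \<in> C" "0 \<le> c" for x c
  proof -
    have "(\<lambda>i. c * coords b x i) \<in> coords b ` C"
      using reg that unfolding regular_cone_coord_def by blast
    then show ?thesis
      by (simp add: mem flip: coords_scaleR)
  qed
  show ?thesis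
    using ne scale[of _ 0] by (auto simp: convex_cone_iff add scale)
qed

section \<open>Sets given by a single conic constraint\<close>

text \<open>Unlike in \<open>K_representable\<close>, no variables are projected out:
  \<open>K_representation_on\<close> asks for the solution set in all variables. Rows with index
  from \<open>n\<close> on are cut off by \<open>vecn\<close>.\<close>

definition conic_rep :: "cone_fam \<Rightarrow> 'a::euclidean_space set \<Rightarrow> bool" where
  "conic_rep K S \<longleftrightarrow>
     (\<exists>n C (A :: nat \<Rightarrow> 'a) c. C \<in> K n \<and> S = {x. vecn n (\<lambda>i. c i - A i \<bullet> x) \<in> C})"

lemma conic_repI:
  "\<lbrakk>C \<in> K n; S = {x. vecn n (\<lambda>i. c i - A i \<bullet> x) \<in> C}\<rbrakk> \<Longrightarrow> conic_rep K S"
  unfolding conic_rep_def by blast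

section \<open>Building blocks of conic constraint systems\<close>

lemma conic_rep_halfspace:
  fixes a :: "'a::euclidean_space"
  assumes "cone_family K"
  shows "conic_rep K {x. a \<bullet> x \<le> \<beta>}"
proof -
  have "{x \<in> topspace (Euclidean_space 1). 0 \<le> x 0} \<in> K 1"
    using assms by (simp add: cone_family_def)
  moreover have "{x. a \<bullet> x \<le> \<beta>} = {x. vecn 1 (\<lambda>i. \<beta> - a \<bullet> x)
      \<in> {x \<in> topspace (Euclidean_space 1). 0 \<le> x 0}}"
    by (auto simp: vecn_def topspace_Euclidean_space)
  ultimately show ?thesis
    by (rule conic_repI)
qed

text \<open>The rows of the second constraint are stacked below those of the first, and the family
  is closed under products.\<close>

lemma conic_rep_Int:
  fixes S T :: "'a::euclidean_space set"
  assumes K: "cone_family K" and "conic_rep K S" "conic_rep K T"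
  shows "conic_rep K (S \<inter> T)"
proof -
  obtain n C and A :: "nat \<Rightarrow> 'a" and c
    where S: "C \<in> K n" "S = {x. vecn n (\<lambda>i. c i - A i \<bullet> x) \<in> C}"
    using assms(2) unfolding conic_rep_def by blast
  obtain m D and B :: "nat \<Rightarrow> 'a" and d
    where T: "D \<in> K m" "T = {x. vecn m (\<lambda>i. d i - B i \<bullet> x) \<in> D}"
    using assms(3) unfolding conic_rep_def by blast
  define A' where "A' i = (if i < n then A i else B (i - n))" for i
  define c' where "c' i = (if i < n then c i else d (i - n))" for i
  have "prod_coord n m C D \<in> K (n + m)"
    using K S T by (simp add: cone_family_def)
  moreover have "vecn (n + m) (\<lambda>i. c' i - A' i \<bullet> x) \<in> prod_coord n m C D \<longleftrightarrow> x \<in> S \<inter> T" for x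
  proof -
    have "vecn n (vecn (n + m) (\<lambda>i. c' i - A' i \<bullet> x)) = vecn n (\<lambda>i. c i - A i \<bullet> x)"
      by (auto simp: vecn_def A'_def c'_def)
    moreover have "(\<lambda>i. vecn (n + m) (\<lambda>i. c' i - A' i \<bullet> x) (n + i)) = vecn m (\<lambda>i. d i - B i \<bullet> x)"
      by (auto simp: vecn_def A'_def c'_def)
    moreover have "vecn (n + m) (\<lambda>i. c' i - A' i \<bullet> x) \<in> topspace (Euclidean_space (n + m))"
      by (auto simp: vecn_def topspace_Euclidean_space)
    ultimately show ?thesis
      by (simp add: prod_coord_def S T)
  qed
  then have "S \<inter> T = {x. vecn (n + m) (\<lambda>i. c' i - A' i \<bullet> x) \<in> prod_coord n m C D}"
    by blast
  ultimately show ?thesis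
    by (rule conic_repI)
qed

text \<open>A scalar equation is a pair of opposite inequalities; induction over the basis collects
  the finitely many components of \<open>T x\<close>.\<close>

lemma conic_rep_kernel:
  fixes T :: "'a::euclidean_space \<Rightarrow> 'b::euclidean_space"
  assumes K: "cone_family K" and "linear T"
  shows "conic_rep K {x. T x = 0}"
proof -
  have "conic_rep K {x. \<forall>b\<in>B. T x \<bullet> b = 0}" if "finite B" for B
    using that
  proof induction
    case empty
    \<comment> \<open>The whole space is taken as the half-space
      \<open>0 \<bullet> x \<le> 0\<close>.\<close>
    show ?case
      using conic_rep_halfspace[OF K, of 0 0] by simp
  next
    case (insert b B)
    let ?a = "adjoint T b"
    have "T x \<bullet> b = ?a \<bullet> x" for x
      by (simp add: adjoint_works[OF \<open>linear T\<close>] inner_commute)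
    then have "{x. \<forall>b\<in>insert b B. T x \<bullet> b = 0} =
        {x. ?a \<bullet> x \<le> 0} \<inter> ({x. (- ?a) \<bullet> x \<le> 0} \<inter> {x. \<forall>b\<in>B. T x \<bullet> b = 0})"
      by auto
    then show ?case
      using insert.IH by (simp only: conic_rep_Int[OF K] conic_rep_halfspace[OF K])
  qed
  from this[OF finite_Basis] show ?thesis
    by (simp add: euclidean_all_zero_iff)
qed

text \<open>In the frame that places \<open>C\<close> in the family, the rows of \<open>T\<close>
  are the vectors \<open>adjoint T (b i)\<close>.\<close>

lemma conic_rep_affine_vimage:
  fixes T :: "'a::euclidean_space \<Rightarrow> 'b::euclidean_space"
  assumes "in_family C K" "linear T"
  shows "conic_rep K {x. q - T x \<in> C}"
proof -
  obtain b where b: "orthonormal_frame b" "coords b ` C \<in> K DIM('b)"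
    using assms(1) by (auto simp: in_family_def)
  have "coords b (q - T x) = vecn DIM('b) (\<lambda>i. q \<bullet> b i - adjoint T (b i) \<bullet> x)" for x
    by (simp add: coords_def inner_diff_left adjoint_works[OF \<open>linear T\<close>] inner_commute[of _ x])
  then have "{x. q - T x \<in> C} =
      {x. vecn DIM('b) (\<lambda>i. q \<bullet> b i - adjoint T (b i) \<bullet> x) \<in> coords b ` C}"
    by (metis inj_image_mem_iff[OF inj_coords[OF b(1)]])
  with b(2) show ?thesis
    by (rule conic_repI)
qed

text \<open>As \<open>coords b\<close> preserves inner products, taking the dual commutes with
  passing to coordinates, so the same frame \<open>b\<close> serves for the dual cone.\<close>

lemma conic_rep_dual_cone_vimage:
  fixes T :: "'a::euclidean_space \<Rightarrow> 'b::euclidean_space"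
  assumes "cone_family K" "in_family C K" "linear T"
  shows "conic_rep K {x. T x \<in> dual_cone C}"
proof -
  obtain b where b: "orthonormal_frame b" "coords b ` C \<in> K DIM('b)"
    using assms(2) by (auto simp: in_family_def)
  have "dual_coord DIM('b) (coords b ` C) \<in> K DIM('b)"
    using assms(1) b by (simp add: cone_family_def)
  moreover have "coords b (T x) = vecn DIM('b) (\<lambda>i. 0 - (- adjoint T (b i)) \<bullet> x)" for x
    by (simp add: coords_def adjoint_works[OF \<open>linear T\<close>] inner_commute[of _ x])
  moreover have "coords b v \<in> dual_coord DIM('b) (coords b ` C) \<longleftrightarrow> v \<in> dual_cone C" for v
    by (auto simp: dual_coord_def dual_cone_def inner_coords[OF b(1)])
       (simp add: coords_def vecn_def topspace_Euclidean_space)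
  ultimately have "{x. T x \<in> dual_cone C} = {x. vecn DIM('b) (\<lambda>i. 0 - (- adjoint T (b i)) \<bullet> x)
      \<in> dual_coord DIM('b) (coords b ` C)}"
    by metis
  with \<open>dual_coord _ _ \<in> _\<close> show ?thesis
    by (rule conic_repI)
qed

text \<open>A row on the product space splits into its components, which are the coefficients of
  \<open>x\<close>, \<open>f\<close>, \<open>t\<close> and \<open>u\<close>.\<close>

lemma K_representation_onI:
  fixes S :: "('x::euclidean_space \<times> 'y::euclidean_space \<times> real \<times> 'u::euclidean_space) set"
  assumes "conic_rep K S"
    and "\<And>x y. x \<in> X \<Longrightarrow> y \<in> Y \<Longrightarrow>
      ereal (\<psi> x y) = (INF (f, t, u) \<in> {(f, t, u). (x, f, t, u) \<in> S}. ereal (f \<bullet> y + t))"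
  shows "K_representation_on K X Y \<psi> S"
proof -
  obtain n C and A :: "nat \<Rightarrow> 'x \<times> 'y \<times> real \<times> 'u" and c
    where C: "C \<in> K n" and S: "S = {x. vecn n (\<lambda>i. c i - A i \<bullet> x) \<in> C}"
    using assms(1) unfolding conic_rep_def by blast
  let ?R = "\<lambda>i. fst (A i)" and ?P = "\<lambda>i. fst (snd (A i))"
    and ?p = "\<lambda>i. fst (snd (snd (A i)))" and ?Q = "\<lambda>i. snd (snd (snd (A i)))"
  have "A i \<bullet> (x, f, t, u) = ?P i \<bullet> f + t * ?p i + ?Q i \<bullet> u + ?R i \<bullet> x" for i x f t u
    by (simp add: inner_prod_def)
  then have "S = {(x, f, t, u).
      vecn n (\<lambda>i. c i - (?P i \<bullet> f + t * ?p i + ?Q i \<bullet> u + ?R i \<bullet> x)) \<in> C}"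
    by (auto simp: S)
  with C have "\<exists>n C P p Q R s. C \<in> K n \<and> S = {(x, f, t, u).
      vecn n (\<lambda>i. s i - (P i \<bullet> f + t * p i + Q i \<bullet> u + R i \<bullet> x)) \<in> C}"
    by (intro exI[of _ n] exI[of _ C] exI[of _ ?P] exI[of _ ?p] exI[of _ ?Q] exI[of _ ?R]
        exI[of _ c] conjI)
  with assms(2) show ?thesis
    unfolding K_representation_on_def by blast
qed

section \<open>Conic duality\<close>

text \<open>A finitely generated cone is closed, so a point outside it can be strictly separated
  from it. This is why plain feasibility suffices for linear inequalities.\<close>

lemma affine_Farkas:
  fixes g :: "'i \<Rightarrow> 'a::euclidean_space"
  assumes fin: "finite I" and feas: "\<forall>i\<in>I. g i \<bullet> x0 \<le> \<beta> i"
    and bound: "\<And>x. \<forall>i\<in>I. g i \<bullet> x \<le> \<beta> i \<Longrightarrow> c \<bullet> x \<le> t"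
  obtains m where "\<forall>i\<in>I. 0 \<le> m i" "(\<Sum>i\<in>I. m i *\<^sub>R g i) = c" "(\<Sum>i\<in>I. m i * \<beta> i) \<le> t"
proof -
  \<comment> \<open>The generator \<open>(0, 1)\<close> absorbs the slack in the inequality for the
    right-hand sides.\<close>
  define gens where "gens = insert (0, 1) ((\<lambda>i. (g i, \<beta> i)) ` I)"
  define N where "N = convex_cone hull gens"
  define M where "M = {p. \<exists>m. (\<forall>i\<in>I. 0 \<le> m i) \<and>
    fst p = (\<Sum>i\<in>I. m i *\<^sub>R g i) \<and> (\<Sum>i\<in>I. m i * \<beta> i) \<le> snd p}"
  have "N \<subseteq> M"
    unfolding N_def
  proof (rule hull_minimal)
    have "(g i, \<beta> i) \<in> M" if "i \<in> I" for i
    proof -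
      let ?m = "\<lambda>j. if j = i then 1 else (0::real)"
      have "(\<Sum>j\<in>I. ?m j *\<^sub>R g j) = (\<Sum>j\<in>I. if j = i then g j else 0)"
        "(\<Sum>j\<in>I. ?m j * \<beta> j) = (\<Sum>j\<in>I. if j = i then \<beta> j else 0)"
        by (auto intro: sum.cong)
      then show ?thesis
        using fin that unfolding M_def by (intro CollectI exI[of _ ?m]) auto
    qed
    moreover have "(0, 1) \<in> M"
      unfolding M_def by (intro CollectI exI[of _ "\<lambda>_. 0"]) auto
    ultimately show "gens \<subseteq> M"
      by (auto simp: gens_def)
    have "0 \<in> M"
      unfolding M_def by (intro CollectI exI[of _ "\<lambda>_. 0"]) auto
    moreover have "p + q \<in> M" if pq: "p \<in> M" "q \<in> M" for p q
    proof -
      obtain m1 where "\<forall>i\<in>I. 0 \<le> m1 i" "fst p = (\<Sum>i\<in>I. m1 i *\<^sub>R g i)"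
        "(\<Sum>i\<in>I. m1 i * \<beta> i) \<le> snd p"
        using pq(1) unfolding M_def by blast
      moreover obtain m2 where "\<forall>i\<in>I. 0 \<le> m2 i" "fst q = (\<Sum>i\<in>I. m2 i *\<^sub>R g i)"
        "(\<Sum>i\<in>I. m2 i * \<beta> i) \<le> snd q"
        using pq(2) unfolding M_def by blast
      ultimately show ?thesis
        unfolding M_def
        by (intro CollectI exI[of _ "\<lambda>i. m1 i + m2 i"])
           (auto simp: scaleR_add_left distrib_right sum.distrib)
    qed
    moreover have "r *\<^sub>R p \<in> M" if p: "p \<in> M" and r: "0 \<le> r" for p r
    proof -
      obtain m where "\<forall>i\<in>I. 0 \<le> m i" "fst p = (\<Sum>i\<in>I. m i *\<^sub>R g i)"
        "(\<Sum>i\<in>I. m i * \<beta> i) \<le> snd p"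
        using p unfolding M_def by blast
      then show ?thesis
        using r unfolding M_def
        by (intro CollectI exI[of _ "\<lambda>i. r * m i"])
           (auto simp: scaleR_sum_right mult.assoc mult_left_mono simp flip: sum_distrib_left)
    qed
    ultimately show "convex_cone M"
      by (simp add: convex_cone_iff)
  qed
  moreover have "(c, t) \<in> N"
  proof (rule ccontr)
    assume "(c, t) \<notin> N"
    have "convex_cone N"
      unfolding N_def by (rule convex_cone_convex_cone_hull)
    have "closed N"
      unfolding N_def gens_def using fin by (intro closed_convex_cone_hull) simp
    moreover have "convex N"
      unfolding N_def by (rule convex_convex_cone_hull)
    ultimately obtain a b where a: "a \<bullet> (c, t) < b" "\<forall>p\<in>N. b < a \<bullet> p"
      using separating_hyperplane_closed_point \<open>(c, t) \<notin> N\<close> by metis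
    have "b < 0"
      using a(2) convex_cone_contains_0[OF \<open>convex_cone N\<close>] by fastforce
    \<comment> \<open>A negative value could be rescaled by \<open>b / (a \<bullet> p)\<close>,
      positive because \<open>b < 0\<close>, to equal \<open>b\<close> exactly, against strict
      separation.\<close>
    have nonneg: "0 \<le> a \<bullet> p" if "p \<in> N" for p
    proof (rule ccontr)
      assume neg: "\<not> 0 \<le> a \<bullet> p"
      then have "(b / (a \<bullet> p)) *\<^sub>R p \<in> N"
        using \<open>b < 0\<close> that
        by (intro convex_cone_scaleR[OF \<open>convex_cone N\<close>]) (auto simp: divide_nonpos_nonpos)
      then have "b < a \<bullet> ((b / (a \<bullet> p)) *\<^sub>R p)"
        using a(2) by blast
      then show False
        using neg by simp
    qed
    obtain h \<eta> where h: "a = (h, \<eta>)"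
      by fastforce
    have gens: "p \<in> N" if "p \<in> gens" for p
      using that hull_subset[of gens convex_cone] by (auto simp: N_def)
    have "0 \<le> \<eta>"
      using nonneg[OF gens, of "(0, 1)"] by (simp add: gens_def h inner_prod_def)
    have hg: "0 \<le> h \<bullet> g i + \<eta> * \<beta> i" if "i \<in> I" for i
      using nonneg[OF gens, of "(g i, \<beta> i)"] that by (simp add: gens_def h inner_prod_def)
    have hc: "h \<bullet> c + \<eta> * t < 0"
      using a(1) \<open>b < 0\<close> by (simp add: h inner_prod_def)
    show False
    \<comment> \<open>For \<open>\<eta> = 0\<close> the feasible set recedes along
      \<open>- h\<close> while \<open>c\<close> grows; for \<open>\<eta> > 0\<close> the point
      \<open>- h / \<eta>\<close> is feasible and violates the bound.\<close>
    proof (cases "\<eta> = 0")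
      case True
      have "c \<bullet> x0 \<le> t"
        using bound feas by blast
      \<comment> \<open>This step length makes the value of \<open>c\<close> at
        \<open>x0 - s *\<^sub>R h\<close> equal to \<open>t + 1\<close>.\<close>
      define s where "s = (t - c \<bullet> x0 + 1) / - (h \<bullet> c)"
      have "0 \<le> s"
        using hc True \<open>c \<bullet> x0 \<le> t\<close> unfolding s_def by (intro divide_nonneg_nonneg) auto
      have "g i \<bullet> (x0 - s *\<^sub>R h) \<le> \<beta> i" if "i \<in> I" for i
      proof -
        have "0 \<le> s * (g i \<bullet> h)"
          using hg[OF that] True \<open>0 \<le> s\<close> by (simp add: inner_commute)
        moreover have "g i \<bullet> x0 \<le> \<beta> i"
          using feas that by blast
        ultimately show ?thesis
          by (simp add: inner_diff_right)
      qed
      then have "c \<bullet> (x0 - s *\<^sub>R h) \<le> t"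
        using bound by blast
      moreover have "s * (c \<bullet> h) = - (t - c \<bullet> x0 + 1)"
        using hc True by (simp add: s_def inner_commute)
      ultimately show False
        by (simp add: inner_diff_right)
    next
      case False
      then have "0 < \<eta>"
        using \<open>0 \<le> \<eta>\<close> by simp
      have "g i \<bullet> (- (1 / \<eta>) *\<^sub>R h) \<le> \<beta> i" if "i \<in> I" for i
        using hg[OF that] \<open>0 < \<eta>\<close> by (simp add: field_simps inner_commute)
      then have "c \<bullet> (- (1 / \<eta>) *\<^sub>R h) \<le> t"
        using bound by blast
      then show False
        using hc \<open>0 < \<eta>\<close> by (simp add: field_simps inner_commute)
    qed
  qed
  ultimately have "(c, t) \<in> M"
    by blast
  then show ?thesis
    unfolding M_def using that by auto
qed

section \<open>Duality under essential strict feasibility\<close>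

lemma linear_orth_proj: "linear (orth_proj I)"
  by (auto intro!: linearI
      simp: orth_proj_def inner_add_left scaleR_add_left sum.distrib scaleR_sum_right algebra_simps)

lemma orth_proj_orthogonal:
  assumes "pairwise orthogonal I" "\<forall>i\<in>I. norm i = 1" "j \<in> I"
  shows "orth_proj I w \<bullet> j = 0"
proof -
  have "finite I"
    using assms(1) by (rule pairwise_orthogonal_imp_finite)
  have "(\<Sum>i\<in>I. (w \<bullet> i) * (i \<bullet> j)) = (\<Sum>i\<in>I. if i = j then w \<bullet> j else 0)"
  proof (rule sum.cong)
    fix i assume "i \<in> I"
    then show "(w \<bullet> i) * (i \<bullet> j) = (if i = j then w \<bullet> j else 0)"
      using assms by (auto simp: pairwise_def orthogonal_def dot_square_norm)
  qed simp
  then show ?thesis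
    using \<open>finite I\<close> \<open>j \<in> I\<close> by (simp add: orth_proj_def inner_diff_left inner_sum_left)
qed

text \<open>The two factors of the cone are treated in turn. Separation over the polyhedron
  \<open>D\<close> of the linear inequalities yields a multiplier for the \<open>L\<close>-part,
  where the strictly feasible point excludes a degenerate hyperplane; Farkas then supplies
  multipliers for the linear inequalities, for which no strict slack is available.\<close>

lemma conic_duality:
  fixes A :: "'v::euclidean_space \<Rightarrow> 'k::euclidean_space"
  assumes "linear A" and ess: "ess_strictly_feasible C A a"
    and bound: "\<And>x. a - A x \<in> C \<Longrightarrow> c \<bullet> x \<le> t"
  obtains \<mu> where "\<mu> \<in> dual_cone C" "\<And>x. \<mu> \<bullet> A x = c \<bullet> x" "a \<bullet> \<mu> \<le> t"
proof -
  obtain I L x0 where I: "pairwise orthogonal I" "\<forall>i\<in>I. norm i = 1"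
    and L: "regular_cone_in {w. \<forall>i\<in>I. w \<bullet> i = 0} L"
    and C: "C = {w. (\<forall>i\<in>I. 0 \<le> w \<bullet> i) \<and> orth_proj I w \<in> L}"
    and x0: "\<forall>i\<in>I. 0 \<le> (a - A x0) \<bullet> i"
      "orth_proj I (a - A x0) \<in> (top_of_set {w. \<forall>i\<in>I. w \<bullet> i = 0}) interior_of L"
    using ess unfolding ess_strictly_feasible_def by blast
  let ?V = "{w. \<forall>i\<in>I. w \<bullet> i = 0}"
  have "finite I"
    using I(1) by (rule pairwise_orthogonal_imp_finite)
  \<comment> \<open>Pulled back along the projection, \<open>L\<close> becomes a cone that is solid in the whole space.\<close>
  define L' where "L' = {w. orth_proj I w \<in> L}"
  note proj = linear_orth_proj[of I]
  \<comment> \<open>By continuity the slack at \<open>x0\<close> may be moved a little in any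
    direction. The direction used later is the normal of the separating hyperplane.\<close>
  have interior: "\<exists>e>0. a - A x0 - e *\<^sub>R \<nu> \<in> L'" for \<nu>
  proof -
    obtain W where W: "open W" "orth_proj I (a - A x0) \<in> W" "?V \<inter> W \<subseteq> L"
      using x0(2) by (auto simp: interior_of_def openin_open)
    have "isCont (\<lambda>e. orth_proj I (a - A x0 - e *\<^sub>R \<nu>)) 0"
      by (intro isCont_o2[OF _ linear_continuous_at[OF proj[unfolded linear_conv_bounded_linear]]]
          continuous_intros)
    then have "eventually (\<lambda>e. orth_proj I (a - A x0 - e *\<^sub>R \<nu>) \<in> W) (at 0)"
      using W(1,2) unfolding isCont_def by (intro topological_tendstoD) auto
    then obtain d where "0 < d"
      "\<And>e. e \<noteq> 0 \<Longrightarrow> dist e 0 < d \<Longrightarrow> orth_proj I (a - A x0 - e *\<^sub>R \<nu>) \<in> W"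
      unfolding eventually_at by blast
    then have "0 < d / 2" "orth_proj I (a - A x0 - (d / 2) *\<^sub>R \<nu>) \<in> W"
      by auto
    then show ?thesis
      using W(3) orth_proj_orthogonal[OF I] unfolding L'_def by blast
  qed
  have L_ne: "L \<noteq> {}"
    using L interior_of_subset[of "top_of_set ?V" L] by (auto simp: regular_cone_in_def)
  then have L0: "0 \<in> L"
    using L cone_contains_0[of L] unfolding regular_cone_in_def by blast
  have L'_cone: "r *\<^sub>R w \<in> L'" if "w \<in> L'" "0 \<le> r" for r w
    using that L by (auto simp: L'_def linear_scale[OF proj] regular_cone_in_def cone_def)
  have L'_convex: "convex L'"
    using convex_linear_vimage[OF proj, of L] L by (simp add: L'_def vimage_def regular_cone_in_def)
  have L'0: "0 \<in> L'"
    by (simp add: L'_def linear_0[OF proj] L0)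
  have adj: "(a - A x) \<bullet> i = a \<bullet> i - adjoint A i \<bullet> x" for x i
    by (simp add: inner_diff_left adjoint_works[OF \<open>linear A\<close>] inner_commute[of _ x])
  define D where "D = {x. \<forall>i\<in>I. adjoint A i \<bullet> x \<le> a \<bullet> i}"
  have in_C: "a - A x \<in> C \<longleftrightarrow> x \<in> D \<and> a - A x \<in> L'" for x
    by (auto simp: C L'_def D_def adj)
  have "x0 \<in> D"
    using x0(1) by (simp add: D_def adj)
  have "convex D"
  proof -
    have "D = (\<Inter>i\<in>I. {x. adjoint A i \<bullet> x \<le> a \<bullet> i})"
      by (auto simp: D_def)
    then show ?thesis
      by (simp add: convex_INT convex_halfspace_le)
  qed
  \<comment> \<open>\<open>E\<close> consists of the pairs
    \<open>(a - A x, c \<bullet> x - t)\<close> with \<open>x\<close> in \<open>D\<close>. Writing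
    it as a translate of a linear image gives convexity at once.\<close>
  define E where "E = (\<lambda>p. (a, - t) + p) ` (\<lambda>x. (- A x, c \<bullet> x)) ` D"
  have "linear (\<lambda>x. (- A x, c \<bullet> x))"
    by (auto intro!: linearI
        simp: linear_add[OF \<open>linear A\<close>] linear_scale[OF \<open>linear A\<close>] inner_add_right)
  then have "convex E"
    unfolding E_def by (intro convex_translation convex_linear_image \<open>convex D\<close>)
  moreover have "convex (L' \<times> {0<..} :: ('k \<times> real) set)"
    by (intro convex_Times L'_convex convex_real_interval)
  moreover have "E \<noteq> {}" "L' \<times> {0<..} \<noteq> ({} :: ('k \<times> real) set)"
    using \<open>x0 \<in> D\<close> L'0 by (auto simp: E_def intro: gt_ex)
  \<comment> \<open>A common point would be a feasible \<open>x\<close> with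
    \<open>c \<bullet> x > t\<close>; the half-line is open for this reason.\<close>
  moreover have "E \<inter> (L' \<times> {0<..}) = {}"
  proof -
    have "c \<bullet> x \<le> t" if "x \<in> D" "a - A x \<in> L'" for x
      using bound in_C that by blast
    then show ?thesis
      by (force simp: E_def)
  qed
  ultimately obtain q b where "q \<noteq> 0" and qE: "\<And>p. p \<in> E \<Longrightarrow> q \<bullet> p \<le> b"
    and qL: "\<And>p. p \<in> L' \<times> {0<..} \<Longrightarrow> b \<le> q \<bullet> p"
    using separating_hyperplane_sets by metis
  obtain \<nu> \<tau> where q: "q = (\<nu>, \<tau>)"
    by fastforce
  have le_b: "\<nu> \<bullet> (a - A x) + \<tau> * (c \<bullet> x - t) \<le> b" if "x \<in> D" for x
    using qE[of "(a - A x, c \<bullet> x - t)"] that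
    by (force simp: E_def q inner_prod_def image_image)
  have b_le: "b \<le> \<nu> \<bullet> w + \<tau> * r" if "w \<in> L'" "0 < r" for w r
    using qL[of "(w, r)"] that by (simp add: q inner_prod_def)
  \<comment> \<open>The separated set is stable under positive scaling, so a functional bounded
    below on it is nonnegative. The factor \<open>s\<close> pushes a negative value down to
    \<open>- (\<bar>b\<bar> + 1)\<close>.\<close>
  have nonneg: "0 \<le> \<nu> \<bullet> w + \<tau> * r" if "w \<in> L'" "0 < r" for w r
  proof (rule ccontr)
    assume neg: "\<not> ?thesis"
    define \<kappa> where "\<kappa> = \<nu> \<bullet> w + \<tau> * r"
    define s where "s = (\<bar>b\<bar> + 1) / - \<kappa>"
    have "0 < s"
      using neg unfolding s_def by (intro divide_pos_pos) (auto simp: \<kappa>_def)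
    then have "b \<le> \<nu> \<bullet> (s *\<^sub>R w) + \<tau> * (s * r)"
      using that by (intro b_le L'_cone) auto
    also have "\<dots> = s * \<kappa>"
      by (simp add: \<kappa>_def algebra_simps)
    also have "\<dots> = - (\<bar>b\<bar> + 1)"
      using neg by (simp add: s_def flip: \<kappa>_def)
    finally show False
      by simp
  qed
  have "0 \<le> \<tau>"
    using nonneg[OF L'0, of 1] by simp
  \<comment> \<open>The value \<open>\<kappa> / (\<tau> + 1)\<close> replaces the limit of
    \<open>r\<close> to \<open>0\<close>, which itself lies outside the open half-line.\<close>
  have small: "0 < \<kappa> / (\<tau> + 1)" "\<tau> * (\<kappa> / (\<tau> + 1)) < \<kappa>" if "0 < \<kappa>" for \<kappa>
    using that \<open>0 \<le> \<tau>\<close> by (auto simp: field_simps)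
  have "b \<le> 0"
  proof (rule ccontr)
    assume "\<not> b \<le> 0"
    then have "0 < b"
      by simp
    from b_le[OF L'0 small(1)[OF this]] small(2)[OF this] show False
      by simp
  qed
  have \<nu>_dual: "0 \<le> \<nu> \<bullet> w" if "w \<in> L'" for w
  proof (rule ccontr)
    assume "\<not> ?thesis"
    then have "0 < - (\<nu> \<bullet> w)"
      by simp
    from nonneg[OF that small(1)[OF this]] small(2)[OF this] show False
      by linarith
  qed
  \<comment> \<open>For \<open>\<tau> = 0\<close> the functional \<open>\<nu>\<close> is nonpositive
    at the slack of \<open>x0\<close>, yet nonnegative after a step along \<open>- \<nu>\<close>.
    This forces \<open>\<nu> = 0\<close>, so the hyperplane would be trivial.\<close>
  have "0 < \<tau>"
  proof (rule ccontr)
    assume "\<not> 0 < \<tau>"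
    then have "\<tau> = 0"
      using \<open>0 \<le> \<tau>\<close> by simp
    obtain e where "0 < e" "a - A x0 - e *\<^sub>R \<nu> \<in> L'"
      using interior by blast
    then have "0 \<le> \<nu> \<bullet> (a - A x0) - e * (\<nu> \<bullet> \<nu>)"
      using \<nu>_dual by (metis inner_diff_right inner_scaleR_right)
    moreover have "\<nu> \<bullet> (a - A x0) \<le> 0"
      using le_b[OF \<open>x0 \<in> D\<close>] \<open>\<tau> = 0\<close> \<open>b \<le> 0\<close> by simp
    ultimately have "e * (\<nu> \<bullet> \<nu>) \<le> 0"
      by simp
    then have "\<nu> = 0"
      using \<open>0 < e\<close> by (metis inner_eq_zero_iff inner_ge_zero mult_le_0_iff not_less order_antisym)
    then show False
      using \<open>\<tau> = 0\<close> \<open>q \<noteq> 0\<close> q by (simp add: zero_prod_def)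
  qed
  define \<nu>' where "\<nu>' = (1 / \<tau>) *\<^sub>R \<nu>"
  \<comment> \<open>With \<open>\<tau>\<close> normalized to \<open>1\<close>, the separation
    becomes an affine consequence of the linear inequalities alone, ready for Farkas.\<close>
  have "(c - adjoint A \<nu>') \<bullet> x \<le> t - a \<bullet> \<nu>'" if "\<forall>i\<in>I. adjoint A i \<bullet> x \<le> a \<bullet> i" for x
  proof -
    have "\<nu> \<bullet> (a - A x) + \<tau> * (c \<bullet> x - t) \<le> 0"
      using le_b[of x] that \<open>b \<le> 0\<close> by (simp add: D_def)
    moreover have "\<nu> = \<tau> *\<^sub>R \<nu>'"
      using \<open>0 < \<tau>\<close> by (simp add: \<nu>'_def)
    ultimately have "\<tau> * (\<nu>' \<bullet> (a - A x) + (c \<bullet> x - t)) \<le> 0"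
      by (simp add: algebra_simps)
    then have "\<nu>' \<bullet> (a - A x) + (c \<bullet> x - t) \<le> 0"
      using \<open>0 < \<tau>\<close> by (simp add: mult_le_0_iff)
    then show ?thesis
      using adj[of x \<nu>'] by (simp add: inner_commute inner_diff_left inner_diff_right)
  qed
  then obtain m where m: "\<forall>i\<in>I. 0 \<le> m i"
    "(\<Sum>i\<in>I. m i *\<^sub>R adjoint A i) = c - adjoint A \<nu>'" "(\<Sum>i\<in>I. m i * (a \<bullet> i)) \<le> t - a \<bullet> \<nu>'"
    using affine_Farkas[OF \<open>finite I\<close>, of "adjoint A" x0 "(\<bullet>) a"] \<open>x0 \<in> D\<close> unfolding D_def by blast
  define \<mu> where "\<mu> = \<nu>' + (\<Sum>i\<in>I. m i *\<^sub>R i)"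
  show thesis
  proof (rule that)
    show "\<mu> \<in> dual_cone C"
      unfolding dual_cone_def
    proof (intro CollectI ballI)
      fix w assume "w \<in> C"
      then have w: "w \<in> L'" "\<forall>i\<in>I. 0 \<le> w \<bullet> i"
        by (auto simp: C L'_def)
      have "0 \<le> w \<bullet> \<nu>'"
        using \<nu>_dual[OF w(1)] \<open>0 < \<tau>\<close> by (simp add: \<nu>'_def inner_commute)
      moreover have "0 \<le> (\<Sum>i\<in>I. m i * (w \<bullet> i))"
        using w m by (intro sum_nonneg) auto
      ultimately show "0 \<le> w \<bullet> \<mu>"
        by (simp add: \<mu>_def inner_add_right inner_sum_right)
    qed
    have "adjoint A \<mu> = c"
      using m(2) adjoint_linear[OF \<open>linear A\<close>]
      by (simp add: \<mu>_def linear_add linear_sum linear_scale)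
    then show "\<mu> \<bullet> A x = c \<bullet> x" for x
      by (metis adjoint_works[OF \<open>linear A\<close>] inner_commute)
    show "a \<bullet> \<mu> \<le> t"
      using m(3) by (simp add: \<mu>_def inner_add_right inner_sum_right)
  qed
qed

section \<open>Affine majorants of concave functions\<close>

text \<open>The point \<open>(y0, \<phi> y0 + \<epsilon>)\<close> is separated from the closed
  hypograph. The slack \<open>\<epsilon>\<close> cannot be dropped: the square root has no affine
  majorant that is exact at the endpoint \<open>0\<close>.\<close>

lemma concave_affine_majorant:
  fixes \<phi> :: "'a::euclidean_space \<Rightarrow> real"
  assumes conc: "concave_on Y \<phi>" and cont: "continuous_on Y \<phi>" and y0: "y0 \<in> Y" and "0 < \<epsilon>"
  obtains f t where "\<And>y. y \<in> Y \<Longrightarrow> \<phi> y \<le> f \<bullet> y + t" "f \<bullet> y0 + t \<le> \<phi> y0 + \<epsilon>"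
proof -
  define H where "H = {(y, r). y \<in> Y \<and> r \<le> \<phi> y}"
  have "convex Y"
    using conc by (rule concave_on_imp_convex)
  have "convex H"
  proof (rule convexI)
    fix p q :: "'a \<times> real" and u v :: real
    assume pq: "p \<in> H" "q \<in> H" and uv: "0 \<le> u" "0 \<le> v" "u + v = 1"
    obtain y r y' r' where eq: "p = (y, r)" "q = (y', r')"
      by fastforce
    have "u * \<phi> y + v * \<phi> y' \<le> \<phi> (u *\<^sub>R y + v *\<^sub>R y')"
      using conc pq uv by (auto simp: concave_on_iff H_def eq)
    moreover have "u * r + v * r' \<le> u * \<phi> y + v * \<phi> y'"
      using pq uv by (intro add_mono mult_left_mono) (auto simp: H_def eq)
    ultimately show "u *\<^sub>R p + v *\<^sub>R q \<in> H"
      using pq uv \<open>convex Y\<close> by (auto simp: H_def eq convex_def)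
  qed
  \<comment> \<open>Near \<open>y0\<close> continuity keeps \<open>\<phi>\<close> below
    \<open>\<phi> y0 + \<epsilon> / 2\<close>, so nearby hypograph points stay too low.\<close>
  have "(y0, \<phi> y0 + \<epsilon>) \<notin> closure H"
  proof
    assume clos: "(y0, \<phi> y0 + \<epsilon>) \<in> closure H"
    obtain d where d: "0 < d" "\<And>y. y \<in> Y \<Longrightarrow> dist y y0 < d \<Longrightarrow> dist (\<phi> y) (\<phi> y0) < \<epsilon> / 2"
      using cont y0 \<open>0 < \<epsilon>\<close> unfolding continuous_on_iff by (metis half_gt_zero)
    have "0 < min d (\<epsilon> / 2)"
      using d \<open>0 < \<epsilon>\<close> by simp
    then obtain p where p: "p \<in> H" "dist p (y0, \<phi> y0 + \<epsilon>) < min d (\<epsilon> / 2)"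
      using clos unfolding closure_approachable by blast
    obtain y r where eq: "p = (y, r)"
      by fastforce
    have "dist y y0 < d" "dist r (\<phi> y0 + \<epsilon>) < \<epsilon> / 2"
      using p(2) dist_fst_le[of p "(y0, \<phi> y0 + \<epsilon>)"] dist_snd_le[of p "(y0, \<phi> y0 + \<epsilon>)"]
      by (auto simp: eq)
    then show False
      using d(2)[of y] p(1) by (auto simp: H_def eq dist_real_def abs_if field_simps split: if_splits)
  qed
  then obtain q b where q: "q \<bullet> (y0, \<phi> y0 + \<epsilon>) < b" "\<forall>p\<in>closure H. b < q \<bullet> p"
    using separating_hyperplane_closed_point[of "closure H"] \<open>convex H\<close>
    by (metis closed_closure convex_closure)
  obtain a \<alpha> where a: "q = (a, \<alpha>)"
    by fastforce
  have below: "b < a \<bullet> y + \<alpha> * \<phi> y" if "y \<in> Y" for y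
    using q(2) closure_subset[of H] that by (force simp: H_def a inner_prod_def)
  have above: "a \<bullet> y0 + \<alpha> * (\<phi> y0 + \<epsilon>) < b"
    using q(1) by (simp add: a inner_prod_def)
  \<comment> \<open>The hyperplane is not vertical, as it passes strictly between two points above
    the same \<open>y0\<close>.\<close>
  have "\<alpha> * \<epsilon> < 0"
    using below[OF y0] above by (simp add: distrib_left)
  then have "\<alpha> < 0"
    using \<open>0 < \<epsilon>\<close> by (simp add: mult_less_0_iff)
  show thesis
  proof (rule that)
    show "\<phi> y \<le> ((- 1 / \<alpha>) *\<^sub>R a) \<bullet> y + b / \<alpha>" if "y \<in> Y" for y
      using below[OF that] \<open>\<alpha> < 0\<close> by (simp add: field_simps)
    show "((- 1 / \<alpha>) *\<^sub>R a) \<bullet> y0 + b / \<alpha> \<le> \<phi> y0 + \<epsilon>"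
      using above \<open>\<alpha> < 0\<close> by (simp add: field_simps)
  qed
qed

section \<open>The bilinear composition\<close>

lemma convex_conic_projection:
  assumes "convex_cone C" "linear A" "linear B" "linear Q"
  shows "convex {(x, z). \<exists>u. cone_le C (A x + B z + Q u) s}"
proof (rule convexI)
  fix p q and \<alpha> \<beta> :: real
  assume pq: "p \<in> {(x, z). \<exists>u. cone_le C (A x + B z + Q u) s}"
    "q \<in> {(x, z). \<exists>u. cone_le C (A x + B z + Q u) s}"
    and ab: "0 \<le> \<alpha>" "0 \<le> \<beta>" "\<alpha> + \<beta> = 1"
  obtain x z x' z' where eq: "p = (x, z)" "q = (x', z')"
    by fastforce
  obtain u u' where u: "s - (A x + B z + Q u) \<in> C" "s - (A x' + B z' + Q u') \<in> C"
    using pq by (auto simp: eq cone_le_def)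
  have "s = (\<alpha> + \<beta>) *\<^sub>R s"
    using ab by simp
  then have "s - (A (\<alpha> *\<^sub>R x + \<beta> *\<^sub>R x') + B (\<alpha> *\<^sub>R z + \<beta> *\<^sub>R z') + Q (\<alpha> *\<^sub>R u + \<beta> *\<^sub>R u')) =
      \<alpha> *\<^sub>R (s - (A x + B z + Q u)) + \<beta> *\<^sub>R (s - (A x' + B z' + Q u'))"
    using assms(2-4)
    by (simp add: linear_add linear_scale scaleR_add_left scaleR_add_right scaleR_diff_right)
  also have "\<dots> \<in> C"
    using u ab assms(1) by (intro convex_cone_add convex_cone_scaleR)
  finally show "\<alpha> *\<^sub>R p + \<beta> *\<^sub>R q \<in> {(x, z). \<exists>u. cone_le C (A x + B z + Q u) s}"
    by (auto simp: eq cone_le_def)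
qed

text \<open>Convex combinations of the graph points \<open>(y, G y)\<close> stay in the hypograph,
  so \<open>G\<close> is concave in the dual order; pairing with \<open>z\<close> makes this scalar.
  Concavity of \<open>G\<close> thus comes from convexity of its hypograph.\<close>

lemma concave_on_inner_hypograph:
  assumes hyp: "convex {(y, w). y \<in> Y \<and> cone_le (dual_cone U) w (G y)}" and "z \<in> U"
  shows "concave_on Y (\<lambda>y. z \<bullet> G y)"
proof -
  have "u *\<^sub>R y + v *\<^sub>R y' \<in> Y \<and>
      cone_le (dual_cone U) (u *\<^sub>R G y + v *\<^sub>R G y') (G (u *\<^sub>R y + v *\<^sub>R y'))"
    if "y \<in> Y" "y' \<in> Y" "0 \<le> u" "0 \<le> v" "u + v = 1" for y y' u v
    using convexD[OF hyp, of "(y, G y)" "(y', G y')" u v] that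
    by (auto simp: cone_le_def dual_cone_def)
  then show ?thesis
    using \<open>z \<in> U\<close>
    by (auto simp: concave_on_iff convex_def cone_le_def dual_cone_def inner_diff_right
        inner_add_right)
qed

lemma convex_on_inner_U_convex:
  assumes "convex X" "U_convex_on U X F" "g \<in> dual_cone U"
  shows "convex_on X (\<lambda>x. F x \<bullet> g)"
  unfolding convex_on_def
proof (intro conjI ballI allI impI \<open>convex X\<close>)
  fix x x' and u v :: real
  assume *: "x \<in> X" "x' \<in> X" "0 \<le> u" "0 \<le> v" "u + v = 1"
  then have "v = 1 - u" "u \<in> {0..1}"
    by auto
  then have "u *\<^sub>R F x + v *\<^sub>R F x' - F (u *\<^sub>R x + v *\<^sub>R x') \<in> U"
    using assms(2) *(1,2) unfolding U_convex_on_def cone_le_def by blast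
  then have "0 \<le> (u *\<^sub>R F x + v *\<^sub>R F x' - F (u *\<^sub>R x + v *\<^sub>R x')) \<bullet> g"
    using assms(3) by (auto simp: dual_cone_def)
  then show "F (u *\<^sub>R x + v *\<^sub>R x') \<bullet> g \<le> u * (F x \<bullet> g) + v * (F x' \<bullet> g)"
    by (simp add: inner_diff_left inner_add_left)
qed

text \<open>Strong duality for maximizing \<open>z \<bullet> w - f \<bullet> y\<close> over all
  triples \<open>(y, w, u)\<close>, with the multiplier equation read off block by block.\<close>

lemma multiplier_of_majorant:
  fixes R :: "'y::euclidean_space \<Rightarrow> 'k::euclidean_space" and S :: "'e::euclidean_space \<Rightarrow> 'k"
    and Q :: "'u::euclidean_space \<Rightarrow> 'k"
  assumes lin: "linear R" "linear S" "linear Q"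
    and ess: "ess_strictly_feasible C (\<lambda>(y, w, u). R y + S w + Q u) s"
    and bound: "\<And>y w u. cone_le C (R y + S w + Q u) s \<Longrightarrow> z \<bullet> w \<le> f \<bullet> y + t"
  obtains \<mu> where "\<mu> \<in> dual_cone C" "f + adjoint R \<mu> = 0" "adjoint S \<mu> = z" "adjoint Q \<mu> = 0"
    "s \<bullet> \<mu> \<le> t"
proof -
  let ?A = "\<lambda>(y, w, u). R y + S w + Q u"
  have "linear ?A"
    using lin by (auto intro!: linearI simp: linear_add linear_scale algebra_simps)
  \<comment> \<open>The zero is the cost of the auxiliary variable \<open>u\<close>; it produces the
    equation \<open>adjoint Q \<mu> = 0\<close>.\<close>
  moreover have "(- f, z, 0) \<bullet> p \<le> t" if "s - ?A p \<in> C" for p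
    using that bound[of "fst p" "fst (snd p)" "snd (snd p)"]
    by (simp add: cone_le_def inner_prod_def case_prod_beta)
  ultimately obtain \<mu> where \<mu>: "\<mu> \<in> dual_cone C" "\<And>p. \<mu> \<bullet> ?A p = (- f, z, 0) \<bullet> p" "s \<bullet> \<mu> \<le> t"
    using conic_duality[OF _ ess] by metis
  have "y \<bullet> (adjoint R \<mu>) = y \<bullet> (- f)" for y
    using \<mu>(2)[of "(y, 0, 0)"] lin
    by (simp add: adjoint_works linear_0 inner_prod_def inner_commute)
  then have "adjoint R \<mu> = - f"
    by (metis vector_eq_ldot)
  moreover have "w \<bullet> (adjoint S \<mu>) = w \<bullet> z" for w
    using \<mu>(2)[of "(0, w, 0)"] lin
    by (simp add: adjoint_works linear_0 inner_prod_def inner_commute)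
  then have "adjoint S \<mu> = z"
    by (metis vector_eq_ldot)
  moreover have "u \<bullet> (adjoint Q \<mu>) = u \<bullet> 0" for u
    using \<mu>(2)[of "(0, 0, u)"] lin
    by (simp add: adjoint_works linear_0 inner_prod_def inner_commute)
  then have "adjoint Q \<mu> = 0"
    by (metis vector_eq_ldot)
  ultimately show thesis
    using that \<mu> by simp
qed

text \<open>Weak duality: the slack is paired with \<open>\<mu>\<close>, and the adjoint equations
  evaluate the result.\<close>

lemma majorant_of_multiplier:
  fixes R :: "'y::euclidean_space \<Rightarrow> 'k::euclidean_space" and S :: "'e::euclidean_space \<Rightarrow> 'k"
    and Q :: "'u::euclidean_space \<Rightarrow> 'k"
  assumes lin: "linear R" "linear S" "linear Q"
    and \<mu>: "\<mu> \<in> dual_cone C" "f + adjoint R \<mu> = 0" "adjoint S \<mu> = z" "adjoint Q \<mu> = 0"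
    and "cone_le C (R y + S w + Q u) s"
  shows "z \<bullet> w \<le> f \<bullet> y + s \<bullet> \<mu>"
proof -
  have "0 \<le> (s - (R y + S w + Q u)) \<bullet> \<mu>"
    using assms by (auto simp: cone_le_def dual_cone_def)
  also have "\<dots> = s \<bullet> \<mu> - (y \<bullet> adjoint R \<mu> + w \<bullet> adjoint S \<mu> + u \<bullet> adjoint Q \<mu>)"
    using lin by (simp add: adjoint_works inner_diff_left inner_add_left)
  also have "adjoint R \<mu> = - f"
    using \<mu>(2) by (simp add: eq_neg_iff_add_eq_0 add.commute)
  finally show ?thesis
    using \<mu> by (simp add: inner_commute)
qed

lemma conic_rep_bilinear_constraints:
  fixes R1 :: "'y::euclidean_space \<Rightarrow> 'k::euclidean_space" and S1 :: "'e::euclidean_space \<Rightarrow> 'k"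
    and Q1 :: "'u::euclidean_space \<Rightarrow> 'k"
    and R2 :: "'x::euclidean_space \<Rightarrow> 'l::euclidean_space" and S2 :: "'e \<Rightarrow> 'l"
    and Q2 :: "'v::euclidean_space \<Rightarrow> 'l"
  assumes K: "cone_family K" and K1: "in_family K1 K" and K2: "in_family K2 K"
    and lin1: "linear R1" "linear S1" "linear Q1" and lin2: "linear R2" "linear S2" "linear Q2"
  shows "conic_rep K {(x, f, t, z, v, \<mu>).
           f + adjoint R1 \<mu> = 0 \<and> t = s1 \<bullet> \<mu> \<and> adjoint S1 \<mu> = z \<and> adjoint Q1 \<mu> = 0 \<and>
           \<mu> \<in> dual_cone K1 \<and> cone_le K2 (R2 x + S2 z + Q2 v) s2}"
proof -
  \<comment> \<open>One linear map per constraint, all on the full space of variables, so that the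
    six solution sets can be intersected.\<close>
  let ?T1 = "\<lambda>(x::'x, f, t::real, z::'e, v::'v, \<mu>). f + adjoint R1 \<mu>"
  let ?T2 = "\<lambda>(x::'x, f::'y, t, z::'e, v::'v, \<mu>). t - s1 \<bullet> \<mu>"
  let ?T3 = "\<lambda>(x::'x, f::'y, t::real, z, v::'v, \<mu>). adjoint S1 \<mu> - z"
  let ?T4 = "\<lambda>(x::'x, f::'y, t::real, z::'e, v::'v, \<mu>). adjoint Q1 \<mu>"
  let ?T5 = "\<lambda>(x::'x, f::'y, t::real, z::'e, v::'v, \<mu>::'k). \<mu>"
  let ?T6 = "\<lambda>(x, f::'y, t::real, z, v, \<mu>::'k). R2 x + S2 z + Q2 v"
  note lin_adj = lin1[THEN adjoint_linear]
  have "linear ?T1" "linear ?T2" "linear ?T3" "linear ?T4" "linear ?T5" "linear ?T6"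
    using lin_adj lin2
    by (auto intro!: linearI simp: linear_add linear_scale inner_add_right algebra_simps)
  then have "conic_rep K ({p. ?T1 p = 0} \<inter> ({p. ?T2 p = 0} \<inter> ({p. ?T3 p = 0} \<inter>
      ({p. ?T4 p = 0} \<inter> ({p. ?T5 p \<in> dual_cone K1} \<inter> {p. s2 - ?T6 p \<in> K2})))))"
    by (intro conic_rep_Int[OF K] conic_rep_kernel[OF K] conic_rep_dual_cone_vimage[OF K K1]
        conic_rep_affine_vimage[OF K2])
  also have "{p. ?T1 p = 0} \<inter> ({p. ?T2 p = 0} \<inter> ({p. ?T3 p = 0} \<inter>
      ({p. ?T4 p = 0} \<inter> ({p. ?T5 p \<in> dual_cone K1} \<inter> {p. s2 - ?T6 p \<in> K2})))) =
      {(x, f, t, z, v, \<mu>).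
           f + adjoint R1 \<mu> = 0 \<and> t = s1 \<bullet> \<mu> \<and> adjoint S1 \<mu> = z \<and> adjoint Q1 \<mu> = 0 \<and>
           \<mu> \<in> dual_cone K1 \<and> cone_le K2 (R2 x + S2 z + Q2 v) s2}"
    by (auto simp: cone_le_def)
  finally show ?thesis .
qed

theorem mainTheorem4:
  fixes K :: cone_fam
    and U :: "'e::euclidean_space set"
    and Y :: "'y::euclidean_space set" and G :: "'y \<Rightarrow> 'e"
    and X :: "'x::euclidean_space set" and F :: "'x \<Rightarrow> 'e"
    and K1 :: "'k::euclidean_space set" and R1 :: "'y \<Rightarrow> 'k" and S1 :: "'e \<Rightarrow> 'k"
    and Q1 :: "'u::euclidean_space \<Rightarrow> 'k" and s1 :: 'k
    and K2 :: "'l::euclidean_space set" and R2 :: "'x \<Rightarrow> 'l" and S2 :: "'e \<Rightarrow> 'l"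
    and Q2 :: "'v::euclidean_space \<Rightarrow> 'l" and s2 :: 'l
  assumes "cone_family K"
    and "in_family U K"
    and "Y \<noteq> {}" and "K_representable K Y"
    and "continuous_on Y G" and "G ` Y \<subseteq> dual_cone U"
    and "in_family K1 K" and "linear R1" and "linear S1" and "linear Q1"
    and "{(y, w). y \<in> Y \<and> cone_le (dual_cone U) w (G y)}
         = {(y, w). \<exists>u. cone_le K1 (R1 y + S1 w + Q1 u) s1}"
    and "ess_strictly_feasible K1 (\<lambda>(y, w, u). R1 y + S1 w + Q1 u) s1"
    and "X \<noteq> {}" and "K_representable K X"
    and "continuous_on X F" and "F ` X \<subseteq> U" and "U_convex_on U X F"
    and "in_family K2 K" and "linear R2" and "linear S2" and "linear Q2"
    and "{(x, z). x \<in> X \<and> cone_le U (F x) z}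
         = {(x, z). \<exists>v. cone_le K2 (R2 x + S2 z + Q2 v) s2}"
  shows "continuous_on (X \<times> Y) (\<lambda>(x, y). F x \<bullet> G y)
    \<and> (\<forall>y\<in>Y. convex_on X (\<lambda>x. F x \<bullet> G y))
    \<and> (\<forall>x\<in>X. concave_on Y (\<lambda>y. F x \<bullet> G y))
    \<and> K_representation_on K X Y (\<lambda>x y. F x \<bullet> G y)
        {(x, f, t, z, v, \<mu>).
           f + adjoint R1 \<mu> = 0 \<and> t = s1 \<bullet> \<mu> \<and> adjoint S1 \<mu> = z \<and> adjoint Q1 \<mu> = 0 \<and>
           \<mu> \<in> dual_cone K1 \<and> cone_le K2 (R2 x + S2 z + Q2 v) s2}"
proof -
  note [simp] = cone_le_def
  have U: "convex_cone U" and K1: "convex_cone K1" and K2: "convex_cone K2"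
    using assms in_family_convex_cone by blast+
  have "convex {(y, w). y \<in> Y \<and> cone_le (dual_cone U) w (G y)}"
    unfolding assms(11) by (intro convex_conic_projection K1 assms)
  then have conc: "concave_on Y (\<lambda>y. z \<bullet> G y)" if "z \<in> U" for z
    using that by (rule concave_on_inner_hypograph)
  have epi: "convex {(x, z). x \<in> X \<and> cone_le U (F x) z}"
    unfolding assms(22) by (intro convex_conic_projection K2 assms)
  \<comment> \<open>Each \<open>x\<close> in \<open>X\<close> lifts to \<open>(x, F x)\<close>, so
    \<open>X\<close> is a projection of the convex epigraph and inherits convexity.\<close>
  have "fst ` {(x, z). x \<in> X \<and> cone_le U (F x) z} = X"
  proof (intro equalityI subsetI)
    fix x assume "x \<in> X"
    then show "x \<in> fst ` {(x, z). x \<in> X \<and> cone_le U (F x) z}"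
      using convex_cone_contains_0[OF U] by (intro image_eqI[of _ _ "(x, F x)"]) auto
  qed auto
  then have "convex X"
    using convex_linear_image[OF linear_fst epi] by simp
  have GU: "0 \<le> z \<bullet> G y" if "z \<in> U" "y \<in> Y" for y z
    using assms(6) that by (auto simp: dual_cone_def)
  let ?S = "{(x, f, t, z, v, \<mu>).
           f + adjoint R1 \<mu> = 0 \<and> t = s1 \<bullet> \<mu> \<and> adjoint S1 \<mu> = z \<and> adjoint Q1 \<mu> = 0 \<and>
           \<mu> \<in> dual_cone K1 \<and> cone_le K2 (R2 x + S2 z + Q2 v) s2}"
  have "K_representation_on K X Y (\<lambda>x y. F x \<bullet> G y) ?S"
  proof (rule K_representation_onI)
    show "conic_rep K ?S"
      by (intro conic_rep_bilinear_constraints assms)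
    fix x y assume x: "x \<in> X" and y: "y \<in> Y"
    show "ereal (F x \<bullet> G y) = (INF (f, t, u) \<in> {(f, t, u). (x, f, t, u) \<in> ?S}. ereal (f \<bullet> y + t))"
    proof (rule antisym)
      show "ereal (F x \<bullet> G y) \<le> (INF (f, t, u) \<in> {(f, t, u). (x, f, t, u) \<in> ?S}. ereal (f \<bullet> y + t))"
      proof (rule INF_greatest, clarsimp)
        fix f v \<mu>
        assume \<mu>: "f + adjoint R1 \<mu> = 0" "adjoint Q1 \<mu> = 0" "\<mu> \<in> dual_cone K1"
          and "s2 - (R2 x + S2 (adjoint S1 \<mu>) + Q2 v) \<in> K2"
        \<comment> \<open>The second constraint says that \<open>adjoint S1 \<mu>\<close> dominates
          \<open>F x\<close>; pairing with \<open>G y\<close> in the dual cone preserves the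
          inequality.\<close>
        then have "(x, adjoint S1 \<mu>) \<in> {(x, z). x \<in> X \<and> cone_le U (F x) z}"
          unfolding assms(22) by auto
        then have "F x \<bullet> G y \<le> adjoint S1 \<mu> \<bullet> G y"
          using GU[OF _ y, of "adjoint S1 \<mu> - F x"] by (simp add: inner_diff_left)
        moreover have "(y, G y) \<in> {(y, w). y \<in> Y \<and> cone_le (dual_cone U) w (G y)}"
          using y by (simp add: dual_cone_def)
        then obtain u where "cone_le K1 (R1 y + S1 (G y) + Q1 u) s1"
          unfolding assms(11) by blast
        then have "adjoint S1 \<mu> \<bullet> G y \<le> f \<bullet> y + s1 \<bullet> \<mu>"
          using majorant_of_multiplier assms \<mu> by blast
        ultimately show "F x \<bullet> G y \<le> f \<bullet> y + s1 \<bullet> \<mu>"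
          by simp
      qed
      show "(INF (f, t, u) \<in> {(f, t, u). (x, f, t, u) \<in> ?S}. ereal (f \<bullet> y + t)) \<le> ereal (F x \<bullet> G y)"
      proof (rule ereal_le_epsilon2)
        fix \<epsilon> :: real assume "0 < \<epsilon>"
        have "F x \<in> U"
          using assms(16) x by blast
        have "(x, F x) \<in> {(x, z). x \<in> X \<and> cone_le U (F x) z}"
          using x convex_cone_contains_0[OF U] by simp
        then obtain v where v: "cone_le K2 (R2 x + S2 (F x) + Q2 v) s2"
          unfolding assms(22) by blast
        have "continuous_on Y (\<lambda>y. F x \<bullet> G y)"
          by (intro continuous_intros assms)
        then obtain f t where maj: "\<And>y'. y' \<in> Y \<Longrightarrow> F x \<bullet> G y' \<le> f \<bullet> y' + t"
          and eps: "f \<bullet> y + t \<le> F x \<bullet> G y + \<epsilon>"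
          using concave_affine_majorant[OF conc[OF \<open>F x \<in> U\<close>] _ y \<open>0 < \<epsilon>\<close>] by metis
        \<comment> \<open>The majorant passes from the graph to the whole hypograph because
          \<open>F x \<in> U\<close> makes pairing with \<open>F x\<close> monotone.\<close>
        have "F x \<bullet> w \<le> f \<bullet> y' + t" if "cone_le K1 (R1 y' + S1 w + Q1 u) s1" for y' w u
        proof -
          have "(y', w) \<in> {(y, w). y \<in> Y \<and> cone_le (dual_cone U) w (G y)}"
            using that unfolding assms(11) by blast
          then have "y' \<in> Y" "F x \<bullet> w \<le> F x \<bullet> G y'"
            using \<open>F x \<in> U\<close> by (auto simp: dual_cone_def inner_diff_right)
          then show ?thesis
            using maj by force
        qed
        then obtain \<mu> where \<mu>: "\<mu> \<in> dual_cone K1" "f + adjoint R1 \<mu> = 0" "adjoint S1 \<mu> = F x"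
          "adjoint Q1 \<mu> = 0" "s1 \<bullet> \<mu> \<le> t"
          using multiplier_of_majorant[OF assms(8-10,12)] by metis
        \<comment> \<open>The choice is \<open>z = F x\<close>, and the constant \<open>t\<close> of
          the majorant is lowered to \<open>s1 \<bullet> \<mu>\<close> to meet the equation for
          \<open>t\<close>.\<close>
        have "(f, s1 \<bullet> \<mu>, F x, v, \<mu>) \<in> {(f, t, u). (x, f, t, u) \<in> ?S}"
          using \<mu> v by simp
        then have "(INF (f, t, u) \<in> {(f, t, u). (x, f, t, u) \<in> ?S}. ereal (f \<bullet> y + t))
            \<le> ereal (f \<bullet> y + s1 \<bullet> \<mu>)"
          by (rule INF_lower2) simp
        also have "\<dots> \<le> ereal (F x \<bullet> G y) + ereal \<epsilon>"
          using eps \<mu>(5) by simp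
        finally show "(INF (f, t, u) \<in> {(f, t, u). (x, f, t, u) \<in> ?S}. ereal (f \<bullet> y + t))
            \<le> ereal (F x \<bullet> G y) + ereal \<epsilon>" .
      qed
    qed
  qed
  moreover have "continuous_on (X \<times> Y) (\<lambda>(x, y). F x \<bullet> G y)"
    unfolding case_prod_beta
    by (intro continuous_intros continuous_on_compose2[OF assms(15)]
        continuous_on_compose2[OF assms(5)]) auto
  moreover have "convex_on X (\<lambda>x. F x \<bullet> G y)" if "y \<in> Y" for y
    using convex_on_inner_U_convex[OF \<open>convex X\<close> assms(17)] assms(6) that by blast
  moreover have "concave_on Y (\<lambda>y. F x \<bullet> G y)" if "x \<in> X" for x
    using conc assms(16) that by blast
  ultimately show ?thesis
    by blast
qed

end
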